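(* Let $\mu\in\mathbb{R}$, $s>0$, let $X_{\mu,s}$ be a Logistic random variable with parameters $\mu$ and $s$, and let $Z$ be a standard normal random variable. Then $$P\left\{|X_{\mu,s}-E[X_{\mu,s}]|\le \sqrt{\mathrm{Var}(X_{\mu,s})}\right\}\approx 0.719641>P\{|Z|\le 1\}\approx 0.6827.$$
   Context: A Logistic random variable with parameters $\mu\in\mathbb{R}$ and $s>0$ has cumulative distribution function $P\{X_{\mu,s}\le x\}=\frac{1}{1+e^{-(x-\mu)/s}}$, $x\in\mathbb{R}$. The symbol $\approx$ means equality after rounding to the number of decimals displayed. *)

theory Defs
  imports "HOL-Probability.Probability"
begin

definition logistic_rv :: "'a measure \<Rightarrow> ('a \<Rightarrow> real) \<Rightarrow> real \<Rightarrow> real \<Rightarrow> bool" where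
  "logistic_rv M X \<mu> s \<longleftrightarrow>
     prob_space M \<and> X \<in> borel_measurable M \<and>
     (\<forall>x. cdf (distr M borel X) x = 1 / (1 + exp (- (x - \<mu>) / s)))"

definition std_normal_rv :: "'a measure \<Rightarrow> ('a \<Rightarrow> real) \<Rightarrow> bool" where
  "std_normal_rv M Z \<longleftrightarrow> prob_space M \<and> distributed M lborel Z std_normal_density"

text \<open>The relation written \<open>x \<approx> y\<close> in the text, where \<open>y\<close> is displayed with \<open>d\<close> decimals:
  rounding \<open>x\<close> to the nearest multiple of \<open>10 ^ -d\<close> (halves rounded up) gives exactly \<open>y\<close>.\<close>

definition approx_decimals :: "nat \<Rightarrow> real \<Rightarrow> real \<Rightarrow> bool" where
  "approx_decimals d x y \<longleftrightarrow> real_of_int (round (x * 10 ^ d)) / 10 ^ d = y"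

end

theory Submission
  imports Defs
begin

text \<open>The standardized variable \<open>Y = (X - \<mu>) / s\<close> has the even density
  \<open>exp (- x) / (1 + exp (- x))\<^sup>2\<close>, so \<open>E[X] = \<mu>\<close>. Integrating the expansion of this density in
  powers of \<open>exp (- x)\<close> term by term against \<open>x\<^sup>2\<close> gives \<open>E[Y\<^sup>2] = 4 * (1 - 1/4 + 1/9 - \<dots>) = \<pi>\<^sup>2 / 3\<close>.
  Hence the first probability is \<open>(1 - q) / (1 + q)\<close> with \<open>q = exp (- \<pi> / sqrt 3)\<close>, whatever \<open>\<mu>\<close>
  and \<open>s\<close> are. Taylor polynomials of \<open>exp\<close> of even and odd length enclose both this number and the
  normal density.\<close>

section \<open>The standard logistic density and its distribution function\<close>

definition logistic_density :: "real \<Rightarrow> real" where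
  "logistic_density x = exp (- x) / (1 + exp (- x))\<^sup>2"

lemma logistic_density_nonneg: "0 \<le> logistic_density x"
  by (simp add: logistic_density_def)

text \<open>Evenness serves three times: to reflect half-lines, to double the half-line second
  moment, and to make the mean vanish.\<close>

lemma logistic_density_minus: "logistic_density (- x) = logistic_density x"
proof -
  have "1 + exp x = exp x * (1 + exp (- x))"
    by (simp add: distrib_left flip: exp_add)
  then have "logistic_density (- x) = exp x / (exp x * (1 + exp (- x)))\<^sup>2"
    by (simp add: logistic_density_def)
  also have "\<dots> = exp (- x) / (1 + exp (- x))\<^sup>2"
    by (simp add: power_mult_distrib power2_eq_square exp_minus divide_simps)
  finally show ?thesis
    by (simp add: logistic_density_def)
qed

lemma borel_measurable_logistic_density [measurable]:
  "logistic_density \<in> borel_measurable borel"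
  unfolding logistic_density_def by measurable

text \<open>The antiderivative is \<open>1 / (1 + exp (- x))\<close>, with limit 1 at infinity.
  Evenness reflects \<open>{..a}\<close> to \<open>{- a..}\<close>, where the fundamental theorem
  for upper half-lines applies.\<close>

lemma nn_integral_logistic_density_atMost:
  "(\<integral>\<^sup>+ x. ennreal (logistic_density x) * indicator {..a} x \<partial>lborel) = ennreal (1 / (1 + exp (- a)))"
proof -
  have "(\<integral>\<^sup>+ x. ennreal (logistic_density x) * indicator {..a} x \<partial>lborel)
      = (\<integral>\<^sup>+ x. ennreal (logistic_density (- x)) * indicator {..a} (- x) \<partial>lborel)"
    by (subst nn_integral_real_affine[where c="-1" and t=0]) auto
  also have "\<dots> = (\<integral>\<^sup>+ x. ennreal (logistic_density x) * indicator {- a..} x \<partial>lborel)"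
    by (intro nn_integral_cong) (auto simp: logistic_density_minus split: split_indicator)
  also have "\<dots> = ennreal (1 - 1 / (1 + exp a))"
  proof (subst nn_integral_FTC_atLeast[where F="\<lambda>x. 1 / (1 + exp (- x))" and T=1])
    show "((\<lambda>x::real. 1 / (1 + exp (- x))) \<longlongrightarrow> 1) at_top"
    proof -
      have "((\<lambda>x::real. exp (- x)) \<longlongrightarrow> 0) at_top"
        by (rule filterlim_compose[OF exp_at_bot filterlim_uminus_at_bot_at_top])
      then have "((\<lambda>x::real. 1 / (1 + exp (- x))) \<longlongrightarrow> 1 / (1 + 0)) at_top"
        by (intro tendsto_intros) auto
      then show ?thesis by simp
    qed
    show "((\<lambda>x. 1 / (1 + exp (- x))) has_real_derivative logistic_density x) (at x)" for x
      unfolding logistic_density_def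
      by (auto intro!: derivative_eq_intros simp: add_pos_pos less_imp_neq[symmetric] power2_eq_square)
  qed (auto simp: logistic_density_nonneg)
  also have "1 - 1 / (1 + exp a) = 1 / (1 + exp (- a))"
    using add_pos_pos[OF zero_less_one exp_gt_zero[of a]] by (simp add: exp_minus field_simps)
  finally show ?thesis .
qed

section \<open>Second moment of the logistic density\<close>

text \<open>The sum of all inverse squares is \<open>pi^2 / 6\<close>. The even squares contribute a
  quarter of it, and flipping their sign subtracts that quarter twice.\<close>

lemma alternating_inverse_squares_sums:
  "(\<lambda>n. (- 1) ^ n / (real n + 1)\<^sup>2) sums (pi\<^sup>2 / 12)"
proof -
  let ?odd = "\<lambda>n::nat. if odd n then 1 / (real n + 1)\<^sup>2 else 0"
  \<comment> \<open>An odd index \<open>n = 2 * k + 1\<close> carries the even square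
    \<open>(n + 1)^2 = 4 * (k + 1)^2\<close>.\<close>
  have "(\<lambda>n. ?odd (2 * n + 1)) sums (pi\<^sup>2 / 24)"
    using sums_divide[OF inverse_squares_sums, of 4]
    by (simp add: power2_eq_square field_simps)
  then have "?odd sums (pi\<^sup>2 / 24)"
    by (subst (asm) sums_mono_reindex[of "\<lambda>n. 2 * n + 1"]) (auto simp: strict_mono_def image_iff, metis oddE Suc_eq_plus1)
  from sums_diff[OF inverse_squares_sums sums_mult[OF this, of 2]]
  have "(\<lambda>n. 1 / (real n + 1)\<^sup>2 - 2 * ?odd n) sums (pi\<^sup>2 / 12)"
    by (simp add: add.commute)
  also have "(\<lambda>n. 1 / (real n + 1)\<^sup>2 - 2 * ?odd n) = (\<lambda>n. (- 1) ^ n / (real n + 1)\<^sup>2)"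
    by auto
  finally show ?thesis .
qed

text \<open>For \<open>x > 0\<close> the derivative of the geometric series with ratio \<open>- exp (- x)\<close> writes the logistic
  density as an alternating sum of exponential densities, whose second moments are \<open>2 / (n + 1)\<^sup>2\<close>.\<close>

lemma has_bochner_integral_logistic_density_half_square:
  "has_bochner_integral lborel (\<lambda>x. indicator {0..} x *\<^sub>R (logistic_density x * x\<^sup>2)) (pi\<^sup>2 / 6)"
proof -
  \<comment> \<open>The Erlang density of order 0 is the exponential density of rate
    \<open>n + 1\<close>, zero for negative \<open>x\<close>; this matches the indicator in the
    claim.\<close>
  define e where "e n x = erlang_density 0 (real n + 1) x * x\<^sup>2" for n :: nat and x :: real
  define f where "f n x = (- 1) ^ n * e n x" for n :: nat and x :: real
  have e_nonneg: "0 \<le> e n x" for n x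
    by (simp add: e_def)
  have e: "has_bochner_integral lborel (e n) (2 / (real n + 1)\<^sup>2)" for n
  proof (rule has_bochner_integral_nn_integral)
    show "(\<integral>\<^sup>+ x. ennreal (e n x) \<partial>lborel) = ennreal (2 / (real n + 1)\<^sup>2)"
      unfolding e_def by (subst nn_integral_erlang_ith_moment) (auto simp: fact_numeral)
  qed (use e_nonneg in \<open>auto simp: e_def[abs_def]\<close>)
  have norm_f: "norm (f n x) = e n x" for n x
    using e_nonneg by (simp add: f_def abs_mult)
  have f: "integrable lborel (f n)" "integral\<^sup>L lborel (f n) = 2 * ((- 1) ^ n / (real n + 1)\<^sup>2)" for n
    using e[of n] by (auto simp: f_def[abs_def] has_bochner_integral_iff)
  let ?g = "\<lambda>x. indicator {0..} x *\<^sub>R (logistic_density x * x\<^sup>2)"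
  have series: "summable (\<lambda>n. norm (f n x))" "(\<lambda>n. f n x) sums ?g x" for x
  proof -
    have "summable (\<lambda>n. norm (f n x)) \<and> (\<lambda>n. f n x) sums ?g x"
    proof (cases "x > 0")
      case True
      have e_eq: "e n x = real (Suc n) * exp (- x) ^ n * (exp (- x) * x\<^sup>2)" for n
      proof -
        have "exp (- (real n + 1) * x) = exp (- x) ^ n * exp (- x)"
          by (simp add: algebra_simps flip: exp_of_nat_mult exp_add)
        then show ?thesis
          using True by (simp add: e_def erlang_density_def)
      qed
      have "summable (\<lambda>n. real (Suc n) * exp (- x) ^ n)"
        using geometric_deriv_sums[of "exp (- x)"] True by (auto simp: sums_iff)
      then have "summable (\<lambda>n. e n x)"
        unfolding e_eq by (rule summable_mult2)
      moreover have "(\<lambda>n. real (Suc n) * (- exp (- x)) ^ n * (exp (- x) * x\<^sup>2)) sums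
          (1 / (1 - (- exp (- x)))\<^sup>2 * (exp (- x) * x\<^sup>2))"
        using geometric_deriv_sums[of "- exp (- x)"] True by (intro sums_mult2) simp
      moreover have "f n x = real (Suc n) * (- exp (- x)) ^ n * (exp (- x) * x\<^sup>2)" for n
        by (simp add: f_def e_eq power_minus[of "exp (- x)"])
      moreover have "?g x = 1 / (1 - (- exp (- x)))\<^sup>2 * (exp (- x) * x\<^sup>2)"
        using True by (simp add: logistic_density_def)
      ultimately show ?thesis
        unfolding norm_f by simp
    next
      \<comment> \<open>At \<open>x = 0\<close> the ratio \<open>- exp (- x)\<close> has modulus 1,
        outside the disc of convergence, but the factor \<open>x^2\<close> makes every term zero
        there.\<close>
      case False
      then have "f n x = 0" for n
        by (cases "x = 0") (auto simp: f_def e_def erlang_density_def)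
      moreover have "?g x = 0"
        using False by (cases "x = 0") auto
      ultimately show ?thesis
        by (simp only: norm_zero summable_zero sums_zero simp_thms)
    qed
    then show "summable (\<lambda>n. norm (f n x))" "(\<lambda>n. f n x) sums ?g x" by auto
  qed
  \<comment> \<open>The L1 norms of the terms are \<open>2 / (n + 1)^2\<close>; their summability
    justifies exchanging sum and integral.\<close>
  have "summable (\<lambda>n. 2 * (1 / (real n + 1)\<^sup>2))"
    using inverse_squares_sums by (intro summable_mult) (auto simp: sums_iff add.commute)
  then have summable: "summable (\<lambda>n. \<integral>x. norm (f n x) \<partial>lborel)"
    using e unfolding norm_f by (simp add: has_bochner_integral_iff)
  have g: "?g = (\<lambda>x. \<Sum>n. f n x)"
    using series(2) by (auto simp: sums_iff)
  have "integrable lborel ?g"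
    unfolding g by (rule integrable_suminf) (use f series summable in auto)
  moreover have "(\<lambda>n. integral\<^sup>L lborel (f n)) sums (\<integral>x. ?g x \<partial>lborel)"
    unfolding g by (rule sums_integral) (use f series summable in auto)
  moreover have "(\<lambda>n. integral\<^sup>L lborel (f n)) sums (2 * (pi\<^sup>2 / 12))"
    unfolding f by (intro sums_mult alternating_inverse_squares_sums)
  ultimately show ?thesis
    by (auto simp: has_bochner_integral_iff dest: sums_unique2)
qed

lemma has_bochner_integral_logistic_density_square:
  "has_bochner_integral lborel (\<lambda>x. logistic_density x * x\<^sup>2) (pi\<^sup>2 / 3)"
  using has_bochner_integral_even_function[OF has_bochner_integral_logistic_density_half_square]
  by (simp add: logistic_density_minus)

section \<open>Moments and central probabilities of the random variables\<close>

context prob_space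
begin

text \<open>The half-lines \<open>{..a}\<close> determine the law: the event for \<open>a\<close> is
  \<open>X\<close> being at most \<open>\<mu> + s * a\<close>, whose probability equals the integral
  of the density over \<open>{..a}\<close>.\<close>

lemma logistic_standardize:
  assumes "s > 0" and X: "logistic_rv M X \<mu> s"
  shows "distributed M lborel (\<lambda>\<omega>. (X \<omega> - \<mu>) / s) logistic_density"
proof (rule distributedI_borel_atMost)
  have [measurable]: "X \<in> borel_measurable M"
    using X by (simp add: logistic_rv_def)
  show "(\<lambda>\<omega>. (X \<omega> - \<mu>) / s) \<in> borel_measurable M"
    by measurable
  show "(\<integral>\<^sup>+ x. ennreal (logistic_density x * indicator {..a} x) \<partial>lborel) = ennreal (1 / (1 + exp (- a)))" for a
    using nn_integral_logistic_density_atMost[of a]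
    by (simp add: ennreal_mult' ennreal_indicator logistic_density_nonneg)
  show "emeasure M {\<omega> \<in> space M. (X \<omega> - \<mu>) / s \<le> a} = ennreal (1 / (1 + exp (- a)))" for a
  proof -
    have "{\<omega> \<in> space M. (X \<omega> - \<mu>) / s \<le> a} = X -` {..\<mu> + s * a} \<inter> space M"
      using \<open>s > 0\<close> by (auto simp: field_simps)
    then have "prob {\<omega> \<in> space M. (X \<omega> - \<mu>) / s \<le> a} = cdf (distr M borel X) (\<mu> + s * a)"
      by (simp add: cdf_def measure_distr)
    also have "\<dots> = 1 / (1 + exp (- a))"
      using X \<open>s > 0\<close> by (simp add: logistic_rv_def)
    finally show ?thesis
      by (simp add: emeasure_eq_measure)
  qed
qed (auto simp: logistic_density_nonneg)

lemma logistic_moments: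
  assumes "s > 0" and X: "logistic_rv M X \<mu> s"
  shows "expectation X = \<mu>" and "variance X = s\<^sup>2 * (pi\<^sup>2 / 3)"
proof -
  define Y where "Y \<omega> = (X \<omega> - \<mu>) / s" for \<omega>
  have Y: "distributed M lborel Y logistic_density"
    unfolding Y_def by (rule logistic_standardize[OF assms])
  have [measurable]: "Y \<in> borel_measurable M"
    using distributed_measurable[OF Y] by simp
  have X_eq: "X = (\<lambda>\<omega>. \<mu> + s * Y \<omega>)"
    using \<open>s > 0\<close> by (auto simp: Y_def)
  have sq: "integrable M (\<lambda>\<omega>. (Y \<omega>)\<^sup>2)" "expectation (\<lambda>\<omega>. (Y \<omega>)\<^sup>2) = pi\<^sup>2 / 3"
    using has_bochner_integral_logistic_density_square
      distributed_integrable[OF Y, of "\<lambda>x. x\<^sup>2"] distributed_integral[OF Y, of "\<lambda>x. x\<^sup>2"]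
    by (auto simp: has_bochner_integral_iff logistic_density_nonneg)
  \<comment> \<open>On a finite measure space square integrability implies integrability, which the
    odd-function argument for the mean needs.\<close>
  have int: "integrable M Y"
    by (rule square_integrable_imp_integrable) (simp_all add: sq)
  then have "integrable lborel (\<lambda>x. logistic_density x * x)"
    using distributed_integrable[OF Y, of "\<lambda>x. x"] by (simp add: logistic_density_nonneg)
  then have "integrable lborel (\<lambda>x. indicator {0..} x *\<^sub>R (logistic_density x * x))"
    by (intro integrable_mult_indicator) auto
  then have "has_bochner_integral lborel (\<lambda>x. logistic_density x * x) 0"
    by (intro has_bochner_integral_odd_function[OF has_bochner_integral_integrable])
       (auto simp: logistic_density_minus)
  then have "expectation Y = 0"
    using distributed_integral[OF Y, of "\<lambda>x. x"]
    by (auto simp: has_bochner_integral_iff logistic_density_nonneg)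
  then show E: "expectation X = \<mu>"
    using int by (simp add: X_eq prob_space)
  have "variance X = expectation (\<lambda>\<omega>. s\<^sup>2 * (Y \<omega>)\<^sup>2)"
    unfolding E by (simp add: X_eq power_mult_distrib)
  then show "variance X = s\<^sup>2 * (pi\<^sup>2 / 3)"
    using sq by simp
qed

text \<open>The probability is the difference of the distribution function of \<open>Y\<close> at
  \<open>a\<close> and \<open>- a\<close>.\<close>

lemma logistic_prob_within:
  assumes "s > 0" and X: "logistic_rv M X \<mu> s" and "0 \<le> a"
  shows "\<P>(\<omega> in M. \<bar>X \<omega> - \<mu>\<bar> \<le> s * a) = (1 - exp (- a)) / (1 + exp (- a))"
proof -
  define Y where "Y \<omega> = (X \<omega> - \<mu>) / s" for \<omega>
  have Y: "distributed M lborel Y logistic_density"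
    unfolding Y_def by (rule logistic_standardize[OF assms(1,2)])
  have [measurable]: "Y \<in> borel_measurable M"
    using distributed_measurable[OF Y] by simp
  have le: "prob {\<omega> \<in> space M. Y \<omega> \<le> b} = 1 / (1 + exp (- b))" for b
  proof -
    have "emeasure M (Y -` {..b} \<inter> space M) = ennreal (1 / (1 + exp (- b)))"
      by (subst distributed_emeasure[OF Y]) (auto simp: nn_integral_logistic_density_atMost)
    moreover have "{\<omega> \<in> space M. Y \<omega> \<le> b} = Y -` {..b} \<inter> space M"
      by auto
    ultimately show ?thesis
      by (simp add: measure_def add_nonneg_nonneg)
  qed
  \<comment> \<open>The closed event contains the endpoint \<open>Y = - a\<close>, which the
    difference of half-lines omits; it is null because \<open>Y\<close> has a density.\<close>
  have "emeasure M (Y -` {- a} \<inter> space M) = 0"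
    by (subst distributed_emeasure[OF Y]) (auto simp: nn_integral_cmult_indicator)
  then have "AE \<omega> in M. Y \<omega> \<noteq> - a"
    by (intro AE_I[of _ _ "Y -` {- a} \<inter> space M"]) auto
  then have "\<P>(\<omega> in M. \<bar>X \<omega> - \<mu>\<bar> \<le> s * a) = prob ({\<omega> \<in> space M. Y \<omega> \<le> a} - {\<omega> \<in> space M. Y \<omega> \<le> - a})"
  proof (intro measure_eq_AE)
    assume "AE \<omega> in M. Y \<omega> \<noteq> - a"
    have iff: "\<bar>X \<omega> - \<mu>\<bar> \<le> s * a \<longleftrightarrow> - a \<le> Y \<omega> \<and> Y \<omega> \<le> a" for \<omega>
      using \<open>s > 0\<close> by (auto simp: Y_def field_simps abs_le_iff)
    from \<open>AE \<omega> in M. Y \<omega> \<noteq> - a\<close>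
    show "AE \<omega> in M. \<omega> \<in> {\<omega> \<in> space M. \<bar>X \<omega> - \<mu>\<bar> \<le> s * a} \<longleftrightarrow>
        \<omega> \<in> {\<omega> \<in> space M. Y \<omega> \<le> a} - {\<omega> \<in> space M. Y \<omega> \<le> - a}"
      by eventually_elim (auto simp: iff)
    have [measurable]: "X \<in> borel_measurable M"
      using X by (simp add: logistic_rv_def)
    show "{\<omega> \<in> space M. \<bar>X \<omega> - \<mu>\<bar> \<le> s * a} \<in> sets M"
      by measurable
  qed measurable
  also have "\<dots> = prob {\<omega> \<in> space M. Y \<omega> \<le> a} - prob {\<omega> \<in> space M. Y \<omega> \<le> - a}"
    using \<open>0 \<le> a\<close> by (intro finite_measure_Diff) auto
  also have "\<dots> = 1 / (1 + exp (- a)) - 1 / (1 + exp a)"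
    by (simp add: le)
  also have "1 / (1 + exp a) = exp (- a) / (1 + exp (- a))"
    using add_pos_pos[OF zero_less_one exp_gt_zero[of a]] by (simp add: exp_minus field_simps)
  also have "1 / (1 + exp (- a)) - exp (- a) / (1 + exp (- a)) = (1 - exp (- a)) / (1 + exp (- a))"
    by (simp add: diff_divide_distrib)
  finally show ?thesis .
qed

text \<open>This passes to the gauge integral over an interval, where comparison with explicitly
  integrated polynomials is available.\<close>

lemma std_normal_prob_within:
  assumes "distributed M lborel Z std_normal_density"
  shows "\<P>(\<omega> in M. \<bar>Z \<omega>\<bar> \<le> a) = integral {- a..a} std_normal_density"
proof -
  have int: "set_integrable lborel {- a..a} std_normal_density"
    unfolding set_integrable_def by (intro integrable_mult_indicator) auto
  have "emeasure M {\<omega> \<in> space M. \<bar>Z \<omega>\<bar> \<le> a} = emeasure M (Z -` {- a..a} \<inter> space M)"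
    by (intro arg_cong[where f="emeasure M"]) auto
  also have "\<dots> = (\<integral>\<^sup>+ x. ennreal (indicator {- a..a} x *\<^sub>R std_normal_density x) \<partial>lborel)"
    by (subst distributed_emeasure[OF assms])
       (auto intro!: nn_integral_cong split: split_indicator)
  also have "\<dots> = ennreal (LINT x:{- a..a}|lborel. std_normal_density x)"
    using int unfolding set_integrable_def set_lebesgue_integral_def
    by (intro nn_integral_eq_integral) auto
  finally have "\<P>(\<omega> in M. \<bar>Z \<omega>\<bar> \<le> a) = (LINT x:{- a..a}|lborel. std_normal_density x)"
    by (simp add: measure_def set_lebesgue_integral_def integral_nonneg_AE)
  with set_borel_integral_eq_integral(2)[OF int] show ?thesis
    by simp
qed

end

section \<open>Numerical enclosures\<close>

text \<open>The Lagrange remainder has the sign of \<open>x ^ n\<close>. Here \<open>n\<close>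
  counts terms, so the polynomial has degree \<open>n - 1\<close>.\<close>

lemma exp_Taylor_even_le:
  fixes x :: real
  assumes "even n"
  shows "(\<Sum>m<n. x ^ m / fact m) \<le> exp x"
proof -
  obtain t where "exp x = (\<Sum>m<n. x ^ m / fact m) + exp t / fact n * x ^ n"
    using Maclaurin_exp_le by blast
  moreover have "0 \<le> exp t / fact n * x ^ n"
    using assms by (simp add: zero_le_even_power)
  ultimately show ?thesis
    by simp
qed

lemma exp_le_Taylor_odd:
  fixes x :: real
  assumes "odd n" "x \<le> 0"
  shows "exp x \<le> (\<Sum>m<n. x ^ m / fact m)"
proof -
  obtain t where "exp x = (\<Sum>m<n. x ^ m / fact m) + exp t / fact n * x ^ n"
    using Maclaurin_exp_le by blast
  moreover have "exp t / fact n * x ^ n \<le> 0"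
    using assms by (intro mult_nonneg_nonpos) (simp_all add: power_le_zero_eq odd_pos)
  ultimately show ?thesis
    by simp
qed

lemma integral_gauss_bounds:
  "1.71124 \<le> integral {-1..1} (\<lambda>x::real. exp (- x\<^sup>2 / 2))"
  "integral {-1..1} (\<lambda>x::real. exp (- x\<^sup>2 / 2)) \<le> 1.71126"
proof -
  \<comment> \<open>\<open>?p\<close> consists of the first six Taylor terms of \<open>exp\<close>
    at \<open>- x^2 / 2\<close>, with denominators \<open>2^m * m!\<close>, and \<open>?P\<close> is
    its antiderivative. The seventh term turns the lower bound into an upper one.\<close>
  let ?p = "\<lambda>x::real. 1 - x\<^sup>2 / 2 + x ^ 4 / 8 - x ^ 6 / 48 + x ^ 8 / 384 - x ^ 10 / 3840"
  let ?P = "\<lambda>x::real. x - x ^ 3 / 6 + x ^ 5 / 40 - x ^ 7 / 336 + x ^ 9 / 3456 - x ^ 11 / 42240"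
  have p: "(?p has_integral (?P 1 - ?P (- 1))) {-1..1}"
    by (rule fundamental_theorem_of_calculus)
       (auto intro!: derivative_eq_intros simp flip: has_real_derivative_iff_has_vector_derivative)
  have q: "((\<lambda>x. ?p x + x ^ 12 / 46080) has_integral
      ((?P 1 + 1 ^ 13 / 599040) - (?P (- 1) + (- 1) ^ 13 / 599040))) {-1..1}"
    by (rule fundamental_theorem_of_calculus)
       (auto intro!: derivative_eq_intros simp flip: has_real_derivative_iff_has_vector_derivative)
  have lower: "?p x \<le> exp (- x\<^sup>2 / 2)" for x :: real
    using exp_Taylor_even_le[of 6 "- x\<^sup>2 / 2"]
    by (simp add: lessThan_nat_numeral fact_numeral power_divide power_minus' flip: power_mult)
  have upper: "exp (- x\<^sup>2 / 2) \<le> ?p x + x ^ 12 / 46080" for x :: real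
    using exp_le_Taylor_odd[of 7 "- x\<^sup>2 / 2"]
    by (simp add: lessThan_nat_numeral fact_numeral power_divide power_minus' flip: power_mult)
  have "(\<lambda>x::real. exp (- x\<^sup>2 / 2)) integrable_on {-1..1}"
    by (intro integrable_continuous_real continuous_intros) auto
  then have I: "((\<lambda>x::real. exp (- x\<^sup>2 / 2)) has_integral integral {-1..1} (\<lambda>x::real. exp (- x\<^sup>2 / 2))) {-1..1}"
    by (rule integrable_integral)
  show "1.71124 \<le> integral {-1..1} (\<lambda>x::real. exp (- x\<^sup>2 / 2))"
    using has_integral_le[OF p I lower] by simp
  show "integral {-1..1} (\<lambda>x::real. exp (- x\<^sup>2 / 2)) \<le> 1.71126"
    using has_integral_le[OF I q upper] by simp
qed

text \<open>Both bounds lie strictly between 0.68265 and 0.68275, the range that rounds to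
  0.6827.\<close>

lemma integral_std_normal_density_bounds:
  "0.68266 \<le> integral {-1..1} std_normal_density" "integral {-1..1} std_normal_density \<le> 0.68272"
proof -
  have eq: "integral {-1..1} std_normal_density = integral {-1..1} (\<lambda>x::real. exp (- x\<^sup>2 / 2)) / sqrt (2 * pi)"
    by (simp add: std_normal_density_def[abs_def])
  have "2.5066 \<le> sqrt (2 * pi)"
    using pi_approx by (intro real_le_rsqrt) (simp add: power2_eq_square)
  moreover have "sqrt (2 * pi) \<le> 2.5067"
    using pi_approx by (intro real_le_lsqrt) (simp_all add: power2_eq_square)
  ultimately show "0.68266 \<le> integral {-1..1} std_normal_density"
      "integral {-1..1} std_normal_density \<le> 0.68272"
    unfolding eq using integral_gauss_bounds by (auto simp: field_simps)
qed

text \<open>The exponent is divided by 8 so that short Taylor polynomials suffice; the eighth power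
  then restores it.\<close>

lemma exp_minus_pi_div_sqrt3_bounds:
  "0.1630333 \<le> exp (- (pi / sqrt 3))" "exp (- (pi / sqrt 3)) \<le> 0.1630337"
proof -
  define x where "x = pi / (8 * sqrt 3)"
  have s: "1.7320508075 \<le> sqrt 3" "sqrt 3 \<le> 1.7320508076"
    by (rule real_le_rsqrt real_le_lsqrt; simp add: power2_eq_square)+
  have x: "0.22672492 \<le> x" "x \<le> 0.22672493"
    using s pi_approx by (auto simp: x_def field_simps)
  have eq: "exp (- (pi / sqrt 3)) = exp (- x) ^ 8"
    by (simp add: x_def flip: exp_of_nat_mult)
  \<comment> \<open>Since \<open>exp (- x)\<close> decreases in \<open>x\<close>, the upper bound on
    \<open>x\<close> enters here and the lower one below.\<close>
  have lower: "0.79714 \<le> exp (- x)"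
  proof -
    have "(0.79714::real) \<le> (\<Sum>m<8. (- 0.22672493) ^ m / fact m)"
      by (simp add: lessThan_nat_numeral fact_numeral power_divide)
    also have "\<dots> \<le> exp (- 0.22672493)"
      by (rule exp_Taylor_even_le) simp
    also have "\<dots> \<le> exp (- x)"
      using x by simp
    finally show ?thesis .
  qed
  have upper: "exp (- x) \<le> 0.7971401"
  proof -
    have "exp (- x) \<le> exp (- 0.22672492)"
      using x by simp
    moreover have "exp (- 0.22672492 :: real) \<le> (\<Sum>m<7. (- 0.22672492) ^ m / fact m)"
      by (rule exp_le_Taylor_odd) simp_all
    moreover have "(\<Sum>m<7. (- 0.22672492) ^ m / fact m) \<le> (0.7971401 :: real)"
      by (simp add: lessThan_nat_numeral fact_numeral power_divide)
    ultimately show ?thesis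
      by (meson order_trans)
  qed
  show "0.1630333 \<le> exp (- (pi / sqrt 3))"
    using power_mono[OF lower, of 8] unfolding eq by (simp add: power_divide)
  show "exp (- (pi / sqrt 3)) \<le> 0.1630337"
    using power_mono[OF upper, of 8] unfolding eq by (simp add: power_divide)
qed

section \<open>Rounding and the comparison\<close>

text \<open>Naming the integer \<open>k\<close> reduces rounding to linear inequalities, strict on
  both sides so that no tie arises.\<close>

lemma approx_decimalsI:
  assumes "y * 10 ^ d = real_of_int k" "real_of_int k - 1 / 2 < x * 10 ^ d" "x * 10 ^ d < real_of_int k + 1 / 2"
  shows "approx_decimals d x y"
  using round_unique[of "x * 10 ^ d" k] assms by (simp add: approx_decimals_def field_simps)

theorem theorem2p3:
  fixes M :: "'a measure" and N :: "'b measure"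
    and X :: "'a \<Rightarrow> real" and Z :: "'b \<Rightarrow> real"
    and \<mu> s :: real
  assumes "s > 0"
    and "logistic_rv M X \<mu> s"
    and "std_normal_rv N Z"
  shows "approx_decimals 6
           \<P>(\<omega> in M. \<bar>X \<omega> - prob_space.expectation M X\<bar> \<le> sqrt (prob_space.variance M X)) 0.719641
       \<and> \<P>(\<omega> in M. \<bar>X \<omega> - prob_space.expectation M X\<bar> \<le> sqrt (prob_space.variance M X))
           > \<P>(\<omega> in N. \<bar>Z \<omega>\<bar> \<le> 1)
       \<and> approx_decimals 4 \<P>(\<omega> in N. \<bar>Z \<omega>\<bar> \<le> 1) 0.6827"
proof -
  interpret M: prob_space M
    using assms(2) by (simp add: logistic_rv_def)
  interpret N: prob_space N
    using assms(3) by (simp add: std_normal_rv_def)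
  let ?P = "\<P>(\<omega> in M. \<bar>X \<omega> - M.expectation X\<bar> \<le> sqrt (M.variance X))"
  let ?Q = "\<P>(\<omega> in N. \<bar>Z \<omega>\<bar> \<le> 1)"
  let ?e = "exp (- (pi / sqrt 3))"
  \<comment> \<open>The standard deviation has the form \<open>s * a\<close> with
    \<open>a = pi / sqrt 3\<close>, so the probability depends on neither \<open>\<mu>\<close> nor
    \<open>s\<close>.\<close>
  have "sqrt (M.variance X) = s * (pi / sqrt 3)"
    using \<open>s > 0\<close> by (simp add: M.logistic_moments(2)[OF assms(1,2)] real_sqrt_mult real_sqrt_divide)
  then have P: "?P = (1 - ?e) / (1 + ?e)"
    using M.logistic_prob_within[OF assms(1,2), of "pi / sqrt 3"]
    by (simp add: M.logistic_moments(1)[OF assms(1,2)])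
  \<comment> \<open>As \<open>(1 - q) / (1 + q)\<close> decreases in \<open>q\<close>, the bounds on
    \<open>?e\<close> swap; the result stays within half a unit of the sixth decimal of
    0.719641.\<close>
  have P_bounds: "0.7196406 \<le> ?P" "?P \<le> 0.7196413"
    unfolding P using exp_minus_pi_div_sqrt3_bounds by (auto simp: field_simps)
  have Q_bounds: "0.68266 \<le> ?Q" "?Q \<le> 0.68272"
    using N.std_normal_prob_within[of Z 1] assms(3) integral_std_normal_density_bounds
    by (auto simp: std_normal_rv_def)
  show ?thesis
  proof (intro conjI)
    show "approx_decimals 6 ?P 0.719641"
      by (rule approx_decimalsI[where k=719641]) (use P_bounds in \<open>auto\<close>)
    show "approx_decimals 4 ?Q 0.6827"
      by (rule approx_decimalsI[where k=6827]) (use Q_bounds in \<open>auto\<close>)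
    show "?Q < ?P"
      using P_bounds Q_bounds by simp
  qed
qed

end
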